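(* Consider the Markovian change-point model. Fix any $c>0$, $\zeta\in\mathbb R^\kappa$ and $\delta\in\{0,1\}$. The function that maps $\gamma\in\mathbb R_+=[0,\infty)$ to $(1+\gamma)J_c^*(\gamma,\zeta,\delta)\in\mathbb R$ is concave.
   Context: Setup. Fix $2\le K<\infty$, $[K]=\{1,\dots,K\}$, $\mathbb N=\{1,2,\dots\}$. There is a latent process $L_t\in\{0,1\}$, $t\ge0$, with $L_t=0$ for $t<\Theta$ and $L_t=1$ for $t\ge\Theta$ ($\Theta=\Theta_{\mathcal X}$ is the change-point). At each $t\in\mathbb N$ a treatment $X_t\in[K]$ is selected and a response $Y_t$ in a Polish space $\mathbb Y$ is observed; $\mathcal F_t=\sigma(X_s,Y_s:1\le s\le t)$, $\mathcal F_0$ trivial. An assignment rule $\mathcal X=\{X_t\}$ has $X_1$ deterministic and $X_t$ a measurable function of $X_1,\dots,X_{t-1},Y_1,\dots,Y_{t-1}$. Response model: for each $x\in[K]$, $f_x,g_x$ are densities with respect to a $\sigma$-finite measure $\mu$ on $\mathbb Y$; given $X_t=x,L_t=i,\mathcal F_{t-1},L_0,\dots,L_{t-1}$, $Y_t$ has density $f_x$ if $i=0$, $g_x$ if $i=1$. Change-point model: $\mathsf P(L_0=1)=\pi_0\in[0,1)$, $\mathsf P(L_t=1\mid L_{t-1}=0,\mathcal F_{t-1},X_t)=\Pi_t$. Markovian model: $\Pi_t=\Psi(X_t,\mathbb S_{t-1})$, $\mathbb S_t=\Phi(X_t,\mathbb S_{t-1})$ for $t\in\mathbb N$, with $\mathbb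 S_0\in\mathbb R^\kappa$ deterministic, $\kappa\ge0$, $\Psi:[K]\times\mathbb R^\kappa\to[0,1)$, $\Phi:[K]\times\mathbb R^\kappa\to\mathbb R^\kappa$. Posterior odds $\Gamma_t=\mathsf P(L_t=1\mid\mathcal F_t)/\mathsf P(L_t=0\mid\mathcal F_t)$, $\Gamma_0=\pi_0/(1-\pi_0)$. $\mathcal C$ is the class of pairs $(\mathcal X,T)$ with $\mathcal X$ an assignment rule and $T$ an $\{\mathcal F_t\}$-stopping time. $\mathsf P_{\gamma,\zeta},\mathsf E_{\gamma,\zeta}$ denote probability and expectation when $\Gamma_0=\gamma$ (i.e. $\pi_0=\gamma/(1+\gamma)$) and $\mathbb S_0=\zeta$. The optimal cost function is $J_c^*(\gamma,\zeta,0)=\inf_{(\mathcal X,T)\in\mathcal C}\{c\,\mathsf E_{\gamma,\zeta}[T]+\mathsf P_{\gamma,\zeta}(T<\Theta_{\mathcal X})\}$ (process not yet terminated) and $J_c^*(\gamma,\zeta,1)=0$ (process already terminated). *)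

theory Defs
  imports "HOL-Probability.Probability"
begin

text \<open>
  The canonical sample space.  An outcome \<open>(\<theta>, y)\<close> consists of the change-point
  \<open>\<theta> \<in> {0, 1, 2, \<dots>, \<infinity>}\<close> and of the responses \<open>y\<^sub>1, y\<^sub>2, \<dots>\<close>.  The latent process is read off
  from the change-point, so that \<open>L\<^sub>t = 0\<close> for \<open>t < \<theta>\<close> and \<open>L\<^sub>t = 1\<close> for \<open>t \<ge> \<theta>\<close> hold by
  construction.
\<close>

type_synonym 'y path = "enat \<times> (nat \<Rightarrow> 'y)"

definition path_space :: "('y::polish_space) path measure" where
  "path_space = count_space UNIV \<Otimes>\<^sub>M PiM {1..} (\<lambda>_. borel)"

definition change_point :: "'y path \<Rightarrow> enat" where
  "change_point \<omega> = fst \<omega>"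

definition response :: "nat \<Rightarrow> 'y path \<Rightarrow> 'y" where
  "response t \<omega> = snd \<omega> t"

definition latent :: "nat \<Rightarrow> 'y path \<Rightarrow> nat" where
  "latent t \<omega> = (if enat t < change_point \<omega> then 0 else 1)"


text \<open>Histories \<open>(X\<^sub>s, Y\<^sub>s)\<close> for \<open>1 \<le> s \<le> t\<close>, and the \<open>\<sigma>\<close>-algebra they generate.\<close>

definition history_space :: "nat \<Rightarrow> nat \<Rightarrow> (nat \<Rightarrow> nat \<times> ('y::polish_space)) measure" where
  "history_space K t = PiM {1..t} (\<lambda>_. count_space {1..K} \<Otimes>\<^sub>M borel)"

definition history :: "(nat \<Rightarrow> 'y path \<Rightarrow> nat) \<Rightarrow> nat \<Rightarrow> 'y path \<Rightarrow> (nat \<Rightarrow> nat \<times> 'y)" where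
  "history X t \<omega> = (\<lambda>s\<in>{1..t}. (X s \<omega>, response s \<omega>))"

definition filt :: "nat \<Rightarrow> (nat \<Rightarrow> ('y::polish_space) path \<Rightarrow> nat) \<Rightarrow> nat \<Rightarrow> 'y path measure" where
  "filt K X t = vimage_algebra (space path_space) (history X t) (history_space K t)"

text \<open>
  For \<open>t = 1\<close> the history is the unique element of a one-point space, hence \<open>X\<^sub>1\<close> is deterministic.
\<close>

definition assignment_rule :: "nat \<Rightarrow> (nat \<Rightarrow> ('y::polish_space) path \<Rightarrow> nat) \<Rightarrow> bool" where
  "assignment_rule K X \<longleftrightarrow>
     (\<forall>t\<ge>1. \<exists>h \<in> history_space K (t - 1) \<rightarrow>\<^sub>M count_space {1..K}.
        \<forall>\<omega>\<in>space path_space. X t \<omega> = h (history X (t - 1) \<omega>))"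

text \<open>The library's stopping times take values in the index set of the filtration; these may be infinite.\<close>

definition obs_stopping_time ::
    "nat \<Rightarrow> (nat \<Rightarrow> ('y::polish_space) path \<Rightarrow> nat) \<Rightarrow> ('y path \<Rightarrow> enat) \<Rightarrow> bool" where
  "obs_stopping_time K X T \<longleftrightarrow>
     (\<forall>t. {\<omega>\<in>space path_space. T \<omega> \<le> enat t} \<in> sets (filt K X t))"

definition procedures ::
    "nat \<Rightarrow> ((nat \<Rightarrow> ('y::polish_space) path \<Rightarrow> nat) \<times> ('y path \<Rightarrow> enat)) set" where
  "procedures K = {(X, T). assignment_rule K X \<and> obs_stopping_time K X T}"


definition prob_density :: "'y measure \<Rightarrow> ('y \<Rightarrow> real) \<Rightarrow> bool" where
  "prob_density \<mu> h \<longleftrightarrow>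
     h \<in> borel_measurable \<mu> \<and> (\<forall>y. 0 \<le> h y) \<and> (\<integral>\<^sup>+ y. ennreal (h y) \<partial>\<mu>) = 1"

text \<open>\<open>\<real>\<^sup>\<kappa>\<close> for a natural number \<open>\<kappa> \<ge> 0\<close>; it is a single point when \<open>\<kappa> = 0\<close>.\<close>

definition reals_pow :: "nat \<Rightarrow> (nat \<Rightarrow> real) set" where
  "reals_pow \<kappa> = {..<\<kappa>} \<rightarrow>\<^sub>E UNIV"

text \<open>
  The statistic \<open>S\<^sub>t\<close> of the Markovian model, \<open>S\<^sub>0 = \<zeta>\<close>.  It is a function of \<open>X\<^sub>1, \<dots>, X\<^sub>t\<close>, which take
  finitely many values, so \<open>\<Phi>\<close> and \<open>\<Psi>\<close> need not be measurable.
\<close>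

primrec stat :: "(nat \<Rightarrow> 's \<Rightarrow> 's) \<Rightarrow> (nat \<Rightarrow> 'y path \<Rightarrow> nat) \<Rightarrow> 's \<Rightarrow> nat \<Rightarrow> 'y path \<Rightarrow> 's" where
  "stat \<Phi> X \<zeta> 0 \<omega> = \<zeta>"
| "stat \<Phi> X \<zeta> (Suc t) \<omega> = \<Phi> (X (Suc t) \<omega>) (stat \<Phi> X \<zeta> t \<omega>)"

text \<open>\<open>\<sigma>(L\<^sub>t\<^sub>-\<^sub>1, F\<^sub>t\<^sub>-\<^sub>1, X\<^sub>t)\<close> and \<open>\<sigma>(L\<^sub>0, \<dots>, L\<^sub>t, F\<^sub>t\<^sub>-\<^sub>1, X\<^sub>t)\<close>.\<close>

definition transition_algebra ::
    "nat \<Rightarrow> (nat \<Rightarrow> ('y::polish_space) path \<Rightarrow> nat) \<Rightarrow> nat \<Rightarrow> 'y path measure" where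
  "transition_algebra K X t =
     vimage_algebra (space path_space)
       (\<lambda>\<omega>. (latent (t - 1) \<omega>, history X (t - 1) \<omega>, X t \<omega>))
       (count_space {0, 1} \<Otimes>\<^sub>M history_space K (t - 1) \<Otimes>\<^sub>M count_space {1..K})"

definition response_algebra ::
    "nat \<Rightarrow> (nat \<Rightarrow> ('y::polish_space) path \<Rightarrow> nat) \<Rightarrow> nat \<Rightarrow> 'y path measure" where
  "response_algebra K X t =
     vimage_algebra (space path_space)
       (\<lambda>\<omega>. (\<lambda>s\<in>{0..t}. latent s \<omega>, history X (t - 1) \<omega>, X t \<omega>))
       (PiM {0..t} (\<lambda>_. count_space {0, 1}) \<Otimes>\<^sub>M history_space K (t - 1) \<Otimes>\<^sub>M count_space {1..K})"

text \<open>
  \<open>P\<close> is the probability \<open>P\<^sub>\<gamma>\<^sub>,\<^sub>\<zeta>\<close> under the assignment rule \<open>X\<close>: the initial odds are \<open>\<gamma>\<close>,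
  the conditional probability of \<open>L\<^sub>t = 1\<close> on \<open>{L\<^sub>t\<^sub>-\<^sub>1 = 0}\<close> is \<open>\<Psi>(X\<^sub>t, S\<^sub>t\<^sub>-\<^sub>1)\<close>, and the conditional
  distribution of \<open>Y\<^sub>t\<close> has the density \<open>f\<close> or \<open>g\<close> of the treatment \<open>X\<^sub>t\<close>.  These conditions
  determine \<open>P\<close> uniquely (and such a \<open>P\<close> exists by the Ionescu-Tulcea theorem).
\<close>

definition cp_law ::
    "nat \<Rightarrow> ('y::polish_space) measure \<Rightarrow> (nat \<Rightarrow> 'y \<Rightarrow> real) \<Rightarrow> (nat \<Rightarrow> 'y \<Rightarrow> real) \<Rightarrow>
     (nat \<Rightarrow> 's \<Rightarrow> real) \<Rightarrow> (nat \<Rightarrow> 's \<Rightarrow> 's) \<Rightarrow> (nat \<Rightarrow> 'y path \<Rightarrow> nat) \<Rightarrow> real \<Rightarrow> 's \<Rightarrow>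
     'y path measure \<Rightarrow> bool" where
  "cp_law K \<mu> f g \<Psi> \<Phi> X \<gamma> \<zeta> P \<longleftrightarrow>
     prob_space P \<and> sets P = sets path_space \<and>
     measure P {\<omega>\<in>space P. latent 0 \<omega> = 1} = \<gamma> / (1 + \<gamma>) \<and>
     (\<forall>t\<ge>1. AE \<omega> in P. latent (t - 1) \<omega> = 0 \<longrightarrow>
        real_cond_exp P (transition_algebra K X t) (indicat_real {\<omega>\<in>space P. latent t \<omega> = 1}) \<omega>
          = \<Psi> (X t \<omega>) (stat \<Phi> X \<zeta> (t - 1) \<omega>)) \<and>
     (\<forall>t\<ge>1. \<forall>B\<in>sets borel. AE \<omega> in P.
        real_cond_exp P (response_algebra K X t) (indicat_real {\<omega>\<in>space P. response t \<omega> \<in> B}) \<omega>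
          = measure (density \<mu> (\<lambda>y. ennreal ((if latent t \<omega> = 0 then f else g) (X t \<omega>) y))) B)"

text \<open>
  The optimal cost; \<open>\<delta> = 1\<close> means that the process has already terminated.  The law \<open>P\<close> is
  determined by the assignment rule, so the infimum is over the procedures \<open>(X, T)\<close>.
\<close>

definition optimal_cost ::
    "nat \<Rightarrow> ('y::polish_space) measure \<Rightarrow> (nat \<Rightarrow> 'y \<Rightarrow> real) \<Rightarrow> (nat \<Rightarrow> 'y \<Rightarrow> real) \<Rightarrow>
     (nat \<Rightarrow> 's \<Rightarrow> real) \<Rightarrow> (nat \<Rightarrow> 's \<Rightarrow> 's) \<Rightarrow> real \<Rightarrow> real \<Rightarrow> 's \<Rightarrow> nat \<Rightarrow> ennreal" where
  "optimal_cost K \<mu> f g \<Psi> \<Phi> c \<gamma> \<zeta> \<delta> =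
     (if \<delta> = 1 then 0
      else Inf {ennreal c * (\<integral>\<^sup>+ \<omega>. ennreal_of_enat (T \<omega>) \<partial>P)
                  + emeasure P {\<omega>\<in>space P. T \<omega> < change_point \<omega>} | X T P.
                (X, T) \<in> procedures K \<and> cp_law K \<mu> f g \<Psi> \<Phi> X \<gamma> \<zeta> P})"

end

theory Submission
  imports Defs
begin

text \<open>
  Fix a procedure and a law \<open>P\<close> of it with initial odds \<open>\<gamma> > 0\<close>.  Reweighting \<open>P\<close> on \<open>{L\<^sub>0 = 1}\<close> and
  on \<open>{L\<^sub>0 = 0}\<close> yields a law of the same procedure for any other odds \<open>\<gamma>'\<close>, and \<open>1 + \<gamma>'\<close> times its
  cost is affine in \<open>\<gamma>'\<close>.  Hence \<open>(1 + \<gamma>) J(\<gamma>)\<close> is an infimum of affine functions.  At \<open>\<gamma> = 0\<close>, where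
  the reweighting breaks down, concavity is trivial since \<open>0\<close> is an extreme point of the half-line.
  Finiteness follows by stopping at once under a constant rule, whose law is constructed from
  independent draws.
\<close>

lemma (in finite_measure_subalgebra) real_cond_exp_density:
  fixes w h :: "'a \<Rightarrow> real"
  assumes w [measurable]: "w \<in> borel_measurable M" and w_nonneg: "\<And>x. 0 \<le> w x"
    and fin: "finite_measure (density M w)"
    and A: "A \<in> sets F" and wA: "(\<lambda>x. w x * indicator A x) \<in> borel_measurable F"
    and h: "integrable M h" "integrable (density M w) h"
  shows "AE x in density M w. x \<in> A \<longrightarrow> real_cond_exp (density M w) F h x = real_cond_exp M F h x"
proof -
  let ?N = "density M w"
  interpret N: finite_measure_subalgebra ?N F
    using fin subalg by (auto simp: finite_measure_subalgebra_def finite_measure_subalgebra_axioms_def subalgebra_def)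
  have [measurable]: "h \<in> borel_measurable M" using h by auto
  have AM [measurable]: "A \<in> sets M" using A subalg by (auto simp: subalgebra_def)
  have AN: "A \<in> sets ?N" by simp
  note [measurable] = wA A
  have hA: "integrable ?N (\<lambda>x. indicator A x * h x)"
    using h(2) integrable_real_mult_indicator[OF AN] by (simp add: mult.commute)
  have wh: "integrable M (\<lambda>x. w x * h x)"
    using h(2) by (subst (asm) integrable_density) (auto simp: w_nonneg)
  have whA: "integrable M (\<lambda>x. (w x * indicator A x) * h x)"
    using integrable_real_mult_indicator[OF AM wh] by (simp add: ac_simps)
  have eA: "integrable ?N (\<lambda>x. indicator A x * real_cond_exp M F h x)"
    using real_cond_exp_intg(1)[OF whA wA] by (subst integrable_density) (auto simp: w_nonneg ac_simps)
  have 1: "AE x in ?N. real_cond_exp ?N F (\<lambda>x. indicator A x * h x) x = indicator A x * real_cond_exp M F h x"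
  proof (rule N.real_cond_exp_charact[OF _ hA eA])
    fix B assume B [measurable]: "B \<in> sets F"
    have BM [measurable]: "B \<in> sets M" using B subalg by (auto simp: subalgebra_def)
    have [measurable]: "(\<lambda>x. w x * indicator A x * indicator B x) \<in> borel_measurable F" by measurable
    have i: "integrable M (\<lambda>x. (w x * indicator A x * indicator B x) * h x)"
      using integrable_real_mult_indicator[OF BM whA] by (simp add: ac_simps)
    have "(LINT x:B|?N. indicator A x * h x) = (\<integral>x. (w x * indicator A x * indicator B x) * h x \<partial>M)"
      unfolding set_lebesgue_integral_def by (subst integral_density) (auto simp: w_nonneg ac_simps)
    also have "\<dots> = (\<integral>x. (w x * indicator A x * indicator B x) * real_cond_exp M F h x \<partial>M)"
      by (rule real_cond_exp_intg(2)[symmetric, OF i]) auto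
    also have "\<dots> = (LINT x:B|?N. indicator A x * real_cond_exp M F h x)"
      unfolding set_lebesgue_integral_def by (subst integral_density) (auto simp: w_nonneg ac_simps)
    finally show "(LINT x:B|?N. indicator A x * h x) = (LINT x:B|?N. indicator A x * real_cond_exp M F h x)" .
  qed measurable
  have 2: "AE x in ?N. real_cond_exp ?N F (\<lambda>x. indicator A x * h x) x = indicator A x * real_cond_exp ?N F h x"
    by (rule N.real_cond_exp_mult[OF _ _ hA]) auto
  show ?thesis
    using 1 2 by eventually_elim (auto simp: indicator_def split: if_splits)
qed

lemma measurable_change_point [measurable]: "change_point \<in> path_space \<rightarrow>\<^sub>M count_space UNIV"
  unfolding change_point_def path_space_def by measurable

lemma measurable_response: "t \<ge> 1 \<Longrightarrow> response t \<in> path_space \<rightarrow>\<^sub>M borel"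
  unfolding response_def path_space_def by measurable

lemma measurable_latent [measurable]: "latent t \<in> path_space \<rightarrow>\<^sub>M count_space {0, 1}"
proof -
  have "(\<lambda>n. if enat t < n then 0 else 1) \<in> count_space UNIV \<rightarrow>\<^sub>M count_space {0, 1::nat}"
    by simp
  from measurable_compose[OF measurable_change_point this] show ?thesis
    by (simp add: latent_def[abs_def])
qed

lemma measurable_history_if:
  assumes "\<And>s. 1 \<le> s \<Longrightarrow> s \<le> t \<Longrightarrow> X s \<in> path_space \<rightarrow>\<^sub>M count_space {1..K}"
  shows "history X t \<in> path_space \<rightarrow>\<^sub>M history_space K t"
  unfolding history_def[abs_def] history_space_def
  by (intro measurable_restrict measurable_Pair assms measurable_response) auto

lemma measurable_assignment:
  assumes X: "assignment_rule K X" and "t \<ge> 1"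
  shows "X t \<in> path_space \<rightarrow>\<^sub>M count_space {1..K}"
  using \<open>t \<ge> 1\<close>
proof (induction t rule: less_induct)
  case (less t)
  obtain h where h: "h \<in> history_space K (t - 1) \<rightarrow>\<^sub>M count_space {1..K}"
    "\<And>\<omega>. \<omega> \<in> space path_space \<Longrightarrow> X t \<omega> = h (history X (t - 1) \<omega>)"
    using X less.prems unfolding assignment_rule_def by blast
  have "history X (t - 1) \<in> path_space \<rightarrow>\<^sub>M history_space K (t - 1)"
    using less.IH by (intro measurable_history_if) auto
  from measurable_compose[OF this h(1)] show ?case
    by (subst measurable_cong[OF h(2)])
qed

lemma measurable_history:
  assumes "assignment_rule K X"
  shows "history X t \<in> path_space \<rightarrow>\<^sub>M history_space K t"
  using measurable_assignment[OF assms] by (intro measurable_history_if) auto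

lemma subalgebra_vimage_algebra:
  assumes "f \<in> M \<rightarrow>\<^sub>M N"
  shows "subalgebra M (vimage_algebra (space M) f N)"
  using sets_image_in_sets[OF refl assms] by (simp add: subalgebra_def)

lemma subalgebra_transition_algebra:
  assumes X: "assignment_rule K X" and t: "t \<ge> 1"
  shows "subalgebra path_space (transition_algebra K X t)"
  unfolding transition_algebra_def
  by (intro subalgebra_vimage_algebra measurable_Pair measurable_latent measurable_history
      measurable_assignment X t)

lemma subalgebra_response_algebra:
  assumes X: "assignment_rule K X" and t: "t \<ge> 1"
  shows "subalgebra path_space (response_algebra K X t)"
  unfolding response_algebra_def
  by (intro subalgebra_vimage_algebra measurable_Pair measurable_restrict measurable_latent
      measurable_history measurable_assignment X t)

lemma subalgebra_filt:
  assumes X: "assignment_rule K X"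
  shows "subalgebra path_space (filt K X t)"
  unfolding filt_def by (intro subalgebra_vimage_algebra measurable_history X)

lemma measurable_obs_stopping_time:
  assumes X: "assignment_rule K X" and T: "obs_stopping_time K X T"
  shows "T \<in> path_space \<rightarrow>\<^sub>M count_space UNIV"
proof -
  have le: "{\<omega>\<in>space path_space. T \<omega> \<le> enat t} \<in> sets path_space" for t
    using T subalgebra_filt[OF X, of t] by (auto simp: obs_stopping_time_def subalgebra_def)
  have "T -` {n} \<inter> space path_space \<in> sets path_space" for n
  proof (cases n)
    case (enat t)
    have "T -` {n} \<inter> space path_space =
        {\<omega>\<in>space path_space. T \<omega> \<le> enat t} - (\<Union>s<t. {\<omega>\<in>space path_space. T \<omega> \<le> enat s})"
    proof (intro set_eqI iffI)
      fix \<omega> assume "\<omega> \<in> {\<omega>\<in>space path_space. T \<omega> \<le> enat t} - (\<Union>s<t. {\<omega>\<in>space path_space. T \<omega> \<le> enat s})"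
      then show "\<omega> \<in> T -` {n} \<inter> space path_space"
        unfolding enat by (cases "T \<omega>") (auto simp: le_less)
    qed (auto simp: enat)
    then show ?thesis using le by auto
  next
    case infinity
    have "T -` {n} \<inter> space path_space = space path_space - (\<Union>s. {\<omega>\<in>space path_space. T \<omega> \<le> enat s})"
    proof (intro set_eqI iffI)
      fix \<omega> assume "\<omega> \<in> space path_space - (\<Union>s. {\<omega>\<in>space path_space. T \<omega> \<le> enat s})"
      then show "\<omega> \<in> T -` {n} \<inter> space path_space"
        unfolding infinity by (cases "T \<omega>") auto
    qed (auto simp: infinity)
    then show ?thesis using le by auto
  qed
  then show ?thesis by (simp add: measurable_count_space_eq2_countable)
qed

text \<open>
  The density of the law with initial odds \<open>\<gamma>'\<close> with respect to the law with initial odds \<open>\<gamma> > 0\<close>.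
  It depends on \<open>L\<^sub>0\<close> only, and is constant on \<open>{L\<^sub>t\<^sub>-\<^sub>1 = 0}\<close>, so that the conditional laws of the
  model are not affected.
\<close>

definition odds_ratio :: "real \<Rightarrow> real \<Rightarrow> 'y path \<Rightarrow> real" where
  "odds_ratio \<gamma> \<gamma>' \<omega> = (if change_point \<omega> = 0 then \<gamma>' / \<gamma> else 1) * ((1 + \<gamma>) / (1 + \<gamma>'))"

lemma latent_0_eq_1_iff: "latent 0 \<omega> = 1 \<longleftrightarrow> change_point \<omega> = 0"
  by (auto simp: latent_def zero_enat_def[symmetric])

lemma measurable_odds_ratio [measurable]: "odds_ratio \<gamma> \<gamma>' \<in> borel_measurable path_space"
  unfolding odds_ratio_def[abs_def] by measurable

lemma cp_law_density:
  assumes X: "assignment_rule K X" and P: "cp_law K \<mu> f g \<Psi> \<Phi> X \<gamma> \<zeta> P"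
    and "\<gamma> > 0" "\<gamma>' \<ge> 0"
  shows "cp_law K \<mu> f g \<Psi> \<Phi> X \<gamma>' \<zeta> (density P (odds_ratio \<gamma> \<gamma>'))"
proof -
  interpret prob_space P using P by (simp add: cp_law_def)
  have sets [measurable_cong]: "sets P = sets path_space" using P by (simp add: cp_law_def)
  have space: "space P = space path_space" by (rule sets_eq_imp_space_eq[OF sets])
  let ?w = "odds_ratio \<gamma> \<gamma>'"
  let ?N = "density P ?w"
  let ?A = "{\<omega>\<in>space P. latent 0 \<omega> = 1}"
  have w_nonneg: "0 \<le> ?w \<omega>" for \<omega>
    using assms by (simp add: odds_ratio_def)
  have A [measurable]: "?A \<in> events"
    unfolding latent_0_eq_1_iff by measurable
  have pA: "prob ?A = \<gamma> / (1 + \<gamma>)" using P by (simp add: cp_law_def)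
  have w_eq: "?w \<omega> = \<gamma>' / \<gamma> * ((1 + \<gamma>) / (1 + \<gamma>')) * indicator ?A \<omega> + (1 + \<gamma>) / (1 + \<gamma>') * indicator (space P - ?A) \<omega>"
    if "\<omega> \<in> space P" for \<omega>
    using that by (auto simp: odds_ratio_def latent_0_eq_1_iff indicator_def simp del: One_nat_def)
  have int_w: "integrable P ?w"
    by (subst Bochner_Integration.integrable_cong[OF refl w_eq]) (auto intro!: integrable_add integrable_mult_right simp: emeasure_eq_measure)
  have wA: "(\<integral>\<omega>. indicator ?A \<omega> * ?w \<omega> \<partial>P) = \<gamma>' / (1 + \<gamma>')"
  proof -
    have "(\<integral>\<omega>. indicator ?A \<omega> * ?w \<omega> \<partial>P) = (\<integral>\<omega>. (\<gamma>' / \<gamma> * ((1 + \<gamma>) / (1 + \<gamma>'))) * indicator ?A \<omega> \<partial>P)"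
      by (intro Bochner_Integration.integral_cong refl) (auto simp: w_eq indicator_def)
    also have "\<dots> = (\<gamma>' / \<gamma> * ((1 + \<gamma>) / (1 + \<gamma>'))) * prob ?A"
      by simp
    also have "\<dots> = \<gamma>' / (1 + \<gamma>')"
      unfolding pA using assms by (simp add: add_nonneg_eq_0_iff divide_simps)
    finally show ?thesis .
  qed
  have wA': "(\<integral>\<omega>. indicator (space P - ?A) \<omega> * ?w \<omega> \<partial>P) = 1 / (1 + \<gamma>')"
  proof -
    have "(\<integral>\<omega>. indicator (space P - ?A) \<omega> * ?w \<omega> \<partial>P) = (\<integral>\<omega>. ((1 + \<gamma>) / (1 + \<gamma>')) * indicator (space P - ?A) \<omega> \<partial>P)"
      by (intro Bochner_Integration.integral_cong refl) (auto simp: w_eq indicator_def)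
    also have "\<dots> = ((1 + \<gamma>) / (1 + \<gamma>')) * (1 - prob ?A)"
      using prob_compl[OF A] by simp
    also have "\<dots> = 1 / (1 + \<gamma>')"
      unfolding pA using assms by (simp add: add_nonneg_eq_0_iff field_simps)
    finally show ?thesis .
  qed
  have emeasure_N: "emeasure ?N B = ennreal (\<integral>\<omega>. indicator B \<omega> * ?w \<omega> \<partial>P)" if "B \<in> events" for B
  proof -
    have [measurable]: "B \<in> events" by fact
    have "emeasure ?N B = (\<integral>\<^sup>+\<omega>. ennreal (indicator B \<omega> * ?w \<omega>) \<partial>P)"
      using that by (subst emeasure_density) (auto intro!: nn_integral_cong simp: indicator_def)
    also have "\<dots> = ennreal (\<integral>\<omega>. indicator B \<omega> * ?w \<omega> \<partial>P)"
      using integrable_real_mult_indicator[OF that int_w]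
      by (intro nn_integral_eq_integral AE_I2) (simp_all add: mult.commute w_nonneg)
    finally show ?thesis .
  qed
  have prob_N: "prob_space ?N"
  proof
    have "(\<integral>\<omega>. indicator (space P) \<omega> * ?w \<omega> \<partial>P) = (\<integral>\<omega>. indicator ?A \<omega> * ?w \<omega> + indicator (space P - ?A) \<omega> * ?w \<omega> \<partial>P)"
      by (intro Bochner_Integration.integral_cong refl) (auto simp: indicator_def)
    also have "\<dots> = (\<integral>\<omega>. indicator ?A \<omega> * ?w \<omega> \<partial>P) + (\<integral>\<omega>. indicator (space P - ?A) \<omega> * ?w \<omega> \<partial>P)"
      using integrable_real_mult_indicator[OF _ int_w, of ?A] integrable_real_mult_indicator[OF _ int_w, of "space P - ?A"]
      by (intro Bochner_Integration.integral_add) (auto simp: mult.commute)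
    also have "\<dots> = 1"
      unfolding wA wA' using assms by (simp add: add_nonneg_eq_0_iff flip: add_divide_distrib)
    finally show "emeasure ?N (space ?N) = 1"
      using emeasure_N[of "space P"] by simp
  qed
  have meas_N: "measure ?N ?A = \<gamma>' / (1 + \<gamma>')"
    using emeasure_N[OF A] assms unfolding wA by (simp add: measure_def)
  interpret N: prob_space ?N by fact
  have cond_exp: "AE \<omega> in ?N. \<omega> \<in> C \<longrightarrow> real_cond_exp ?N F (indicat_real E) \<omega> = real_cond_exp P F (indicat_real E) \<omega>"
    if F: "subalgebra path_space F" and C: "C \<in> sets F" "(\<lambda>\<omega>. ?w \<omega> * indicator C \<omega>) \<in> borel_measurable F"
      and E: "E \<in> events" for C F E
  proof -
    interpret finite_measure_subalgebra P F
      by unfold_locales (use F sets space in \<open>simp add: subalgebra_def\<close>)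
    show ?thesis
      using C E N.finite_measure_axioms
      by (intro real_cond_exp_density) (auto simp: w_nonneg emeasure_eq_measure N.emeasure_eq_measure)
  qed
  have AE_N: "AE \<omega> in ?N. Q \<omega>" if "AE \<omega> in P. Q \<omega>" for Q
    using that by (subst AE_density) auto
  have 1: "AE \<omega> in ?N. latent (t - 1) \<omega> = 0 \<longrightarrow>
        real_cond_exp ?N (transition_algebra K X t) (indicat_real {\<omega>\<in>space ?N. latent t \<omega> = 1}) \<omega>
          = \<Psi> (X t \<omega>) (stat \<Phi> X \<zeta> (t - 1) \<omega>)" if t: "t \<ge> 1" for t
  proof -
    let ?F = "transition_algebra K X t" and ?E = "{\<omega>\<in>space P. latent t \<omega> = 1}"
    let ?C = "{\<omega>\<in>space path_space. latent (t - 1) \<omega> = 0}"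
    have lat: "latent (t - 1) \<in> ?F \<rightarrow>\<^sub>M count_space {0, 1}"
    proof -
      have "(\<lambda>\<omega>. (latent (t - 1) \<omega>, history X (t - 1) \<omega>, X t \<omega>)) \<in>
        ?F \<rightarrow>\<^sub>M count_space {0, 1} \<Otimes>\<^sub>M history_space K (t - 1) \<Otimes>\<^sub>M count_space {1..K}"
        unfolding transition_algebra_def
        using measurable_Pair[OF measurable_latent[of "t-1"] measurable_Pair[OF measurable_history[OF X, of "t - 1"] measurable_assignment[OF X t]]]
        by (intro measurable_vimage_algebra1) (auto dest: measurable_space)
      from measurable_compose[OF this measurable_fst] show ?thesis by simp
    qed
    have spF: "space ?F = space path_space" by (simp add: transition_algebra_def)
    have C: "?C \<in> sets ?F"
      using measurable_sets[OF lat, of "{0}"] by (simp add: spF vimage_def Int_def conj_commute)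
    have w_C: "?w \<omega> * indicator ?C \<omega> = ((1 + \<gamma>) / (1 + \<gamma>')) * indicator ?C \<omega>" for \<omega>
      by (auto simp: odds_ratio_def latent_def indicator_def split: if_splits)
    have wC: "(\<lambda>\<omega>. ?w \<omega> * indicator ?C \<omega>) \<in> borel_measurable ?F"
      unfolding w_C by (intro borel_measurable_times borel_measurable_const borel_measurable_indicator C)
    have [measurable]: "?E \<in> events"
      using measurable_sets[OF measurable_latent, of "{1}" t] sets
      by (simp add: space vimage_def Int_def conj_commute)
    have "AE \<omega> in P. latent (t - 1) \<omega> = 0 \<longrightarrow> real_cond_exp P ?F (indicat_real ?E) \<omega> = \<Psi> (X t \<omega>) (stat \<Phi> X \<zeta> (t - 1) \<omega>)"
      using P t by (simp add: cp_law_def)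
    from AE_N[OF this] cond_exp[OF subalgebra_transition_algebra[OF X t] C wC \<open>?E \<in> events\<close>] AE_space[of ?N]
    show ?thesis
      by eventually_elim (auto simp: space)
  qed
  have 2: "AE \<omega> in ?N.
        real_cond_exp ?N (response_algebra K X t) (indicat_real {\<omega>\<in>space ?N. response t \<omega> \<in> B}) \<omega>
          = measure (density \<mu> (\<lambda>y. ennreal ((if latent t \<omega> = 0 then f else g) (X t \<omega>) y))) B"
    if t: "t \<ge> 1" and B: "B \<in> sets borel" for t B
  proof -
    let ?F = "response_algebra K X t" and ?E = "{\<omega>\<in>space P. response t \<omega> \<in> B}"
    have lat: "latent 0 \<in> ?F \<rightarrow>\<^sub>M count_space {0, 1}"
    proof -
      have "(\<lambda>\<omega>. \<lambda>s\<in>{0..t}. latent s \<omega>) \<in> path_space \<rightarrow>\<^sub>M PiM {0..t} (\<lambda>_. count_space {0, 1})"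
        by (intro measurable_restrict measurable_latent)
      from measurable_Pair[OF this measurable_Pair[OF measurable_history[OF X, of "t - 1"] measurable_assignment[OF X t]]]
      have "(\<lambda>\<omega>. (\<lambda>s\<in>{0..t}. latent s \<omega>, history X (t - 1) \<omega>, X t \<omega>)) \<in>
        ?F \<rightarrow>\<^sub>M PiM {0..t} (\<lambda>_. count_space {0, 1}) \<Otimes>\<^sub>M history_space K (t - 1) \<Otimes>\<^sub>M count_space {1..K}"
        unfolding response_algebra_def
        by (intro measurable_vimage_algebra1) (auto dest: measurable_space)
      from measurable_compose[OF measurable_compose[OF this measurable_fst] measurable_component_singleton[of 0]]
      show ?thesis by simp
    qed
    have spF: "space ?F = space path_space" by (simp add: response_algebra_def)
    have "{\<omega>\<in>space path_space. latent 0 \<omega> = 1} \<in> sets ?F"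
      using measurable_sets[OF lat, of "{1}"] by (simp add: spF vimage_def Int_def conj_commute)
    then have "(\<lambda>\<omega>. (if latent 0 \<omega> = 1 then \<gamma>' / \<gamma> else 1) * ((1 + \<gamma>) / (1 + \<gamma>'))) \<in> borel_measurable ?F"
      by (intro borel_measurable_times measurable_If) (auto simp: spF)
    then have "?w \<in> borel_measurable ?F"
      unfolding odds_ratio_def[abs_def] latent_0_eq_1_iff .
    then have wC: "(\<lambda>\<omega>. ?w \<omega> * indicator (space ?F) \<omega>) \<in> borel_measurable ?F"
      by simp
    have [measurable]: "?E \<in> events"
      using measurable_sets[OF measurable_response[OF t] B] sets
      by (simp add: space vimage_def Int_def conj_commute)
    have "AE \<omega> in P. real_cond_exp P ?F (indicat_real ?E) \<omega> = measure (density \<mu> (\<lambda>y. ennreal ((if latent t \<omega> = 0 then f else g) (X t \<omega>) y))) B"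
      using P t B by (simp add: cp_law_def)
    from AE_N[OF this] cond_exp[OF subalgebra_response_algebra[OF X t] sets.top wC \<open>?E \<in> events\<close>] AE_space[of ?N]
    show ?thesis
      by eventually_elim (simp add: space spF)
  qed
  show ?thesis
    unfolding cp_law_def using prob_N sets meas_N 1 2 by simp
qed

lemma measurable_early_stopping:
  assumes XT: "(X, T) \<in> procedures K" and sets: "sets P = sets path_space"
  shows "{\<omega>\<in>space P. T \<omega> < change_point \<omega>} \<in> sets P"
proof -
  have [measurable]: "T \<in> P \<rightarrow>\<^sub>M count_space UNIV"
    using XT measurable_cong_sets[OF sets refl]
    by (auto simp: procedures_def intro: measurable_obs_stopping_time)
  have "change_point \<in> P \<rightarrow>\<^sub>M count_space UNIV"
    using measurable_cong_sets[OF sets refl] measurable_change_point by blast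
  then have "Measurable.pred P (\<lambda>\<omega>. i < change_point \<omega>)" for i
    by (rule measurable_compose) simp
  then have "Measurable.pred P (\<lambda>\<omega>. T \<omega> < change_point \<omega>)"
    by (rule measurable_compose_countable) measurable
  then show ?thesis by measurable
qed

lemma procedure_cost_density:
  assumes XT: "(X, T) \<in> procedures K" and sets [measurable_cong]: "sets P = sets path_space"
    and w [measurable]: "w \<in> borel_measurable path_space"
  shows "ennreal c * (\<integral>\<^sup>+ \<omega>. ennreal_of_enat (T \<omega>) \<partial>density P w)
        + emeasure (density P w) {\<omega>\<in>space (density P w). T \<omega> < change_point \<omega>}
      = (\<integral>\<^sup>+ \<omega>. w \<omega> * (ennreal c * ennreal_of_enat (T \<omega>)
          + indicator {\<omega>\<in>space P. T \<omega> < change_point \<omega>} \<omega>) \<partial>P)"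
proof -
  have [measurable]: "T \<in> path_space \<rightarrow>\<^sub>M count_space UNIV"
    using XT by (auto simp: procedures_def intro: measurable_obs_stopping_time)
  have [measurable]: "{\<omega>\<in>space P. T \<omega> < change_point \<omega>} \<in> sets P"
    by (rule measurable_early_stopping[OF XT sets])
  show ?thesis
    by (simp add: nn_integral_density emeasure_density distrib_left nn_integral_add nn_integral_cmult[symmetric] ac_simps)
qed

lemma optimal_cost_le:
  assumes "(X, T) \<in> procedures K" "cp_law K \<mu> f g \<Psi> \<Phi> X \<gamma> \<zeta> P"
  shows "optimal_cost K \<mu> f g \<Psi> \<Phi> c \<gamma> \<zeta> 0 \<le>
    ennreal c * (\<integral>\<^sup>+ \<omega>. ennreal_of_enat (T \<omega>) \<partial>P) + emeasure P {\<omega>\<in>space P. T \<omega> < change_point \<omega>}"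
  using assms unfolding optimal_cost_def by (auto intro!: Inf_lower)

lemma optimal_cost_mix:
  fixes a b :: real and \<mu> :: "('y::polish_space) measure"
  assumes "\<gamma> > 0" "\<gamma>\<^sub>1 \<ge> 0" "\<gamma>\<^sub>2 \<ge> 0" "a \<ge> 0" "b \<ge> 0" "a + b = 1" and \<gamma>: "\<gamma> = a * \<gamma>\<^sub>1 + b * \<gamma>\<^sub>2"
  shows "ennreal (a * (1 + \<gamma>\<^sub>1) / (1 + \<gamma>)) * optimal_cost K \<mu> f g \<Psi> \<Phi> c \<gamma>\<^sub>1 \<zeta> 0
       + ennreal (b * (1 + \<gamma>\<^sub>2) / (1 + \<gamma>)) * optimal_cost K \<mu> f g \<Psi> \<Phi> c \<gamma>\<^sub>2 \<zeta> 0
      \<le> optimal_cost K \<mu> f g \<Psi> \<Phi> c \<gamma> \<zeta> 0"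
proof -
  let ?J = "\<lambda>\<gamma>. optimal_cost K \<mu> f g \<Psi> \<Phi> c \<gamma> \<zeta> 0"
  define \<alpha> \<beta> where "\<alpha> = a * (1 + \<gamma>\<^sub>1) / (1 + \<gamma>)" and "\<beta> = b * (1 + \<gamma>\<^sub>2) / (1 + \<gamma>)"
  have nonneg: "\<alpha> \<ge> 0" "\<beta> \<ge> 0" using assms by (auto simp: \<alpha>_def \<beta>_def)
  have weights: "\<alpha> * odds_ratio \<gamma> \<gamma>\<^sub>1 \<omega> + \<beta> * odds_ratio \<gamma> \<gamma>\<^sub>2 \<omega> = 1" for \<omega> :: "'y path"
  proof -
    have "\<alpha> * ((1 + \<gamma>) / (1 + \<gamma>\<^sub>1)) = a" "\<beta> * ((1 + \<gamma>) / (1 + \<gamma>\<^sub>2)) = b"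
      using assms(1-3) by (simp_all add: \<alpha>_def \<beta>_def)
    then have "\<alpha> * odds_ratio \<gamma> \<gamma>\<^sub>1 \<omega> = a * (if change_point \<omega> = 0 then \<gamma>\<^sub>1 / \<gamma> else 1)"
      "\<beta> * odds_ratio \<gamma> \<gamma>\<^sub>2 \<omega> = b * (if change_point \<omega> = 0 then \<gamma>\<^sub>2 / \<gamma> else 1)"
      unfolding odds_ratio_def by (metis mult.assoc mult.commute)+
    then show ?thesis
      using assms by (auto simp flip: add_divide_distrib)
  qed
  have "ennreal \<alpha> * ?J \<gamma>\<^sub>1 + ennreal \<beta> * ?J \<gamma>\<^sub>2 \<le>
      ennreal c * (\<integral>\<^sup>+ \<omega>. ennreal_of_enat (T \<omega>) \<partial>P) + emeasure P {\<omega>\<in>space P. T \<omega> < change_point \<omega>}"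
    if XT: "(X, T) \<in> procedures K" and P: "cp_law K \<mu> f g \<Psi> \<Phi> X \<gamma> \<zeta> P" for X T P
  proof -
    have X: "assignment_rule K X" using XT by (simp add: procedures_def)
    have sets [measurable_cong]: "sets P = sets path_space" using P by (simp add: cp_law_def)
    have [measurable]: "T \<in> path_space \<rightarrow>\<^sub>M count_space UNIV"
      using XT by (auto simp: procedures_def intro: measurable_obs_stopping_time)
    have [measurable]: "{\<omega>\<in>space P. T \<omega> < change_point \<omega>} \<in> sets P"
      by (rule measurable_early_stopping[OF XT sets])
    define \<phi> where "\<phi> \<omega> = ennreal c * ennreal_of_enat (T \<omega>) + indicator {\<omega>\<in>space P. T \<omega> < change_point \<omega>} \<omega>" for \<omega>
    have [measurable]: "\<phi> \<in> borel_measurable P"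
      unfolding \<phi>_def by measurable
    have J: "?J \<gamma>' \<le> (\<integral>\<^sup>+ \<omega>. ennreal (odds_ratio \<gamma> \<gamma>' \<omega>) * \<phi> \<omega> \<partial>P)" if "\<gamma>' \<ge> 0" for \<gamma>'
      using optimal_cost_le[OF XT cp_law_density[OF X P \<open>\<gamma> > 0\<close> that]]
      unfolding \<phi>_def by (subst (asm) procedure_cost_density[OF XT sets]) auto
    have "ennreal \<alpha> * ?J \<gamma>\<^sub>1 + ennreal \<beta> * ?J \<gamma>\<^sub>2 \<le>
        ennreal \<alpha> * (\<integral>\<^sup>+ \<omega>. ennreal (odds_ratio \<gamma> \<gamma>\<^sub>1 \<omega>) * \<phi> \<omega> \<partial>P) +
        ennreal \<beta> * (\<integral>\<^sup>+ \<omega>. ennreal (odds_ratio \<gamma> \<gamma>\<^sub>2 \<omega>) * \<phi> \<omega> \<partial>P)"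
      by (intro add_mono mult_left_mono J assms) auto
    also have "\<dots> = (\<integral>\<^sup>+ \<omega>. (ennreal \<alpha> * ennreal (odds_ratio \<gamma> \<gamma>\<^sub>1 \<omega>) + ennreal \<beta> * ennreal (odds_ratio \<gamma> \<gamma>\<^sub>2 \<omega>)) * \<phi> \<omega> \<partial>P)"
      by (simp add: nn_integral_add nn_integral_cmult[symmetric] distrib_right mult.assoc)
    also have "\<dots> = (\<integral>\<^sup>+ \<omega>. \<phi> \<omega> \<partial>P)"
    proof (intro nn_integral_cong)
      fix \<omega> :: "'y path"
      have "odds_ratio \<gamma> \<gamma>\<^sub>1 \<omega> \<ge> 0" "odds_ratio \<gamma> \<gamma>\<^sub>2 \<omega> \<ge> 0"
        using assms by (auto simp: odds_ratio_def)
      then have "ennreal \<alpha> * ennreal (odds_ratio \<gamma> \<gamma>\<^sub>1 \<omega>) + ennreal \<beta> * ennreal (odds_ratio \<gamma> \<gamma>\<^sub>2 \<omega>) = 1"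
        using nonneg weights[of \<omega>] by (simp add: ennreal_mult[symmetric] ennreal_plus[symmetric] del: ennreal_plus)
      then show "(ennreal \<alpha> * ennreal (odds_ratio \<gamma> \<gamma>\<^sub>1 \<omega>) + ennreal \<beta> * ennreal (odds_ratio \<gamma> \<gamma>\<^sub>2 \<omega>)) * \<phi> \<omega> = \<phi> \<omega>"
        by simp
    qed
    also have "\<dots> = ennreal c * (\<integral>\<^sup>+ \<omega>. ennreal_of_enat (T \<omega>) \<partial>P) + emeasure P {\<omega>\<in>space P. T \<omega> < change_point \<omega>}"
      unfolding \<phi>_def by (subst nn_integral_add) (auto simp: nn_integral_cmult)
    finally show ?thesis .
  qed
  then show ?thesis
    unfolding \<alpha>_def[symmetric] \<beta>_def[symmetric]
    by (subst (3) optimal_cost_def) (auto intro!: Inf_greatest)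
qed

lemma concave_optimal_cost:
  assumes fin: "\<And>\<gamma>. \<gamma> \<ge> 0 \<Longrightarrow> optimal_cost K \<mu> f g \<Psi> \<Phi> c \<gamma> \<zeta> 0 < \<infinity>"
  shows "concave_on {0..} (\<lambda>\<gamma>. (1 + \<gamma>) * enn2real (optimal_cost K \<mu> f g \<Psi> \<Phi> c \<gamma> \<zeta> 0))"
  unfolding concave_on_iff
proof (intro conjI ballI allI impI)
  let ?J = "\<lambda>\<gamma>. optimal_cost K \<mu> f g \<Psi> \<Phi> c \<gamma> \<zeta> 0"
  fix x y a b :: real
  assume xy: "x \<in> {0..}" "y \<in> {0..}" and ab: "0 \<le> a" "0 \<le> b" "a + b = 1"
  show "a * ((1 + x) * enn2real (?J x)) + b * ((1 + y) * enn2real (?J y))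
      \<le> (1 + (a *\<^sub>R x + b *\<^sub>R y)) * enn2real (?J (a *\<^sub>R x + b *\<^sub>R y))"
  proof (cases "a *\<^sub>R x + b *\<^sub>R y = 0")
    case True
    then have "a = 0 \<or> x = 0" "b = 0 \<or> y = 0"
      using xy ab by (auto simp: add_nonneg_eq_0_iff)
    with ab True show ?thesis
      by (auto simp flip: distrib_right)
  next
    case False
    define z where "z = a * x + b * y"
    have z: "z > 0"
      using False xy ab by (simp add: z_def order_less_le)
    have "ennreal (a * (1 + x) / (1 + z)) * ?J x + ennreal (b * (1 + y) / (1 + z)) * ?J y \<le> ?J z"
      using z xy ab by (intro optimal_cost_mix) (auto simp: z_def)
    moreover have "?J x = ennreal (enn2real (?J x))" "?J y = ennreal (enn2real (?J y))"
      "?J z = ennreal (enn2real (?J z))"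
      using fin[of x] fin[of y] fin[of z] xy z by auto
    ultimately have "ennreal (a * (1 + x) / (1 + z)) * ennreal (enn2real (?J x)) +
        ennreal (b * (1 + y) / (1 + z)) * ennreal (enn2real (?J y)) \<le> ennreal (enn2real (?J z))"
      by metis
    then have "a * (1 + x) / (1 + z) * enn2real (?J x) + b * (1 + y) / (1 + z) * enn2real (?J y) \<le> enn2real (?J z)"
      using xy ab z
      by (simp add: ennreal_mult[symmetric] ennreal_plus[symmetric] del: ennreal_plus times_divide_eq_left)
    then have "(a * (1 + x) * enn2real (?J x) + b * (1 + y) * enn2real (?J y)) / (1 + z) \<le> enn2real (?J z)"
      by (simp add: add_divide_distrib)
    then show ?thesis
      using z by (simp add: z_def[symmetric] pos_divide_le_eq mult.assoc mult.commute)
  qed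
qed simp

lemma (in finite_measure_subalgebra) real_cond_exp_indicator_const:
  fixes c :: real
  assumes A: "A \<in> sets F" and E: "E \<in> sets M"
    and const: "\<And>B. B \<in> sets F \<Longrightarrow> B \<subseteq> A \<Longrightarrow> measure M (B \<inter> E) = c * measure M B"
  shows "AE x in M. x \<in> A \<longrightarrow> real_cond_exp M F (indicat_real E) x = c"
proof -
  have sub: "B \<in> sets M" if "B \<in> sets F" for B
    using that subalg by (auto simp: subalgebra_def)
  note [measurable] = sub[OF A] A E
  have int: "integrable M (\<lambda>x. indicat_real A x * indicat_real E x)"
    by (intro integrable_real_mult_indicator[where f = "indicat_real A", simplified] ) (auto simp: emeasure_eq_measure)
  have "AE x in M. real_cond_exp M F (\<lambda>x. indicat_real A x * indicat_real E x) x = c * indicat_real A x"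
  proof (rule real_cond_exp_charact[OF _ int])
    fix B assume B: "B \<in> sets F"
    note [measurable] = sub[OF B]
    have "(LINT x:B|M. indicat_real A x * indicat_real E x) = (\<integral>x. indicat_real ((B \<inter> A) \<inter> E) x \<partial>M)"
      unfolding set_lebesgue_integral_def
      by (intro Bochner_Integration.integral_cong refl) (auto simp: indicator_def)
    also have "\<dots> = c * measure M (B \<inter> A)"
      using const[of "B \<inter> A"] A B sets.sets_into_space[OF sub[OF B]] by (simp add: Int_absorb2 le_infI1)
    also have "\<dots> = (\<integral>x. c * indicat_real (B \<inter> A) x \<partial>M)"
      using sets.sets_into_space[OF sub[OF B]] by (simp add: Int_absorb2 le_infI1)
    also have "\<dots> = (LINT x:B|M. c * indicat_real A x)"
      unfolding set_lebesgue_integral_def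
      by (intro Bochner_Integration.integral_cong refl) (auto simp: indicator_def)
    finally show "(LINT x:B|M. indicat_real A x * indicat_real E x) = (LINT x:B|M. c * indicat_real A x)" .
  qed (auto simp: emeasure_eq_measure)
  moreover have "AE x in M. real_cond_exp M F (\<lambda>x. indicat_real A x * indicat_real E x) x =
      indicat_real A x * real_cond_exp M F (indicat_real E) x"
    by (rule real_cond_exp_mult[OF _ _ int]) auto
  ultimately show ?thesis
    by eventually_elim (auto simp: indicator_def split: if_splits)
qed

lemma in_vimage_algebra_cong:
  assumes "B \<in> sets (vimage_algebra X f N)" "f \<in> X \<rightarrow> space N"
    and "x \<in> B" "y \<in> X" "f x = f y"
  shows "y \<in> B"
  using assms by (auto simp: sets_vimage_algebra2)

lemma measure_PiM_indep_past:
  fixes M :: "'i :: linorder \<Rightarrow> 'a measure"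
  assumes M: "\<And>i. prob_space (M i)" and S: "S \<in> sets (PiM UNIV M)"
    and past: "\<And>\<omega> \<omega>'. \<omega> \<in> S \<Longrightarrow> \<omega>' \<in> space (PiM UNIV M) \<Longrightarrow> (\<And>i. i < k \<Longrightarrow> \<omega> i = \<omega>' i) \<Longrightarrow> \<omega>' \<in> S"
    and D: "D \<in> sets (M k)"
  shows "measure (PiM UNIV M) (S \<inter> {\<omega>. \<omega> k \<in> D}) = measure (PiM UNIV M) S * measure (M k) D"
proof -
  interpret product_prob_space M "UNIV :: 'i set"
    by (rule product_prob_spaceI) (rule M)
  let ?\<Omega> = "PiM UNIV M"
  have "indep_vars M (\<lambda>i \<omega>. \<omega> i) UNIV"
  proof (subst indep_vars_iff_distr_eq_PiM')
    have "distr ?\<Omega> ?\<Omega> (\<lambda>x. \<lambda>i\<in>UNIV. x i) = distr ?\<Omega> ?\<Omega> (\<lambda>x. x)"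
      by (intro distr_cong refl) auto
    also have "\<dots> = PiM UNIV (\<lambda>i. distr ?\<Omega> (M i) (\<lambda>\<omega>. \<omega> i))"
      by (simp add: distr_id2 PiM_component cong: PiM_cong)
    finally show "distr ?\<Omega> ?\<Omega> (\<lambda>x. \<lambda>i\<in>UNIV. x i) = PiM UNIV (\<lambda>i. distr ?\<Omega> (M i) (\<lambda>\<omega>. \<omega> i))" .
  qed auto
  then have ind: "indep_var (PiM {..<k} M) (\<lambda>\<omega>. \<lambda>i\<in>{..<k}. \<omega> i) (PiM {k} M) (\<lambda>\<omega>. \<lambda>i\<in>{k}. \<omega> i)"
    by (rule indep_var_restrict) auto
  obtain a where a: "a \<in> space ?\<Omega>"
    using not_empty by blast
  define ext where "ext \<eta> = (\<lambda>i\<in>UNIV. if i < k then \<eta> i else a i)" for \<eta> :: "'i \<Rightarrow> 'a"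
  have "ext \<in> PiM {..<k} M \<rightarrow>\<^sub>M ?\<Omega>"
    unfolding ext_def
  proof (rule measurable_restrict)
    fix i :: 'i
    show "(\<lambda>\<eta>. if i < k then \<eta> i else a i) \<in> PiM {..<k} M \<rightarrow>\<^sub>M M i"
      using a by (cases "i < k") (auto simp: space_PiM intro!: measurable_const)
  qed
  then have Xa: "ext -` S \<inter> space (PiM {..<k} M) \<in> sets (PiM {..<k} M)"
    using S by (rule measurable_sets)
  have "(\<lambda>\<eta>. \<eta> k) \<in> PiM {k} M \<rightarrow>\<^sub>M M k"
    by (rule measurable_component_singleton) simp
  then have Xb: "(\<lambda>\<eta>. \<eta> k) -` D \<inter> space (PiM {k} M) \<in> sets (PiM {k} M)"
    using D by (rule measurable_sets)
  have sp: "\<omega> \<in> space ?\<Omega> \<Longrightarrow> \<omega> i \<in> space (M i)" for \<omega> i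
    by (auto simp: space_PiM)
  have Sa: "(\<lambda>\<omega>. \<lambda>i\<in>{..<k}. \<omega> i) -` (ext -` S \<inter> space (PiM {..<k} M)) \<inter> space ?\<Omega> = S"
  proof (intro set_eqI iffI)
    fix \<omega> assume \<omega>: "\<omega> \<in> S"
    then have "\<omega> \<in> space ?\<Omega>" using sets.sets_into_space[OF S] by auto
    moreover have "ext (\<lambda>i\<in>{..<k}. \<omega> i) \<in> S"
      using \<omega> by (rule past) (use a sp \<open>\<omega> \<in> space ?\<Omega>\<close> in \<open>auto simp: ext_def space_PiM\<close>)
    ultimately show "\<omega> \<in> (\<lambda>\<omega>. \<lambda>i\<in>{..<k}. \<omega> i) -` (ext -` S \<inter> space (PiM {..<k} M)) \<inter> space ?\<Omega>"
      by (auto simp: space_PiM)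
  next
    fix \<omega> assume \<omega>: "\<omega> \<in> (\<lambda>\<omega>. \<lambda>i\<in>{..<k}. \<omega> i) -` (ext -` S \<inter> space (PiM {..<k} M)) \<inter> space ?\<Omega>"
    then have "ext (\<lambda>i\<in>{..<k}. \<omega> i) \<in> S" by auto
    then show "\<omega> \<in> S"
      by (rule past) (use \<omega> in \<open>auto simp: ext_def\<close>)
  qed
  have Sb: "(\<lambda>\<omega>. \<lambda>i\<in>{k}. \<omega> i) -` ((\<lambda>\<eta>. \<eta> k) -` D \<inter> space (PiM {k} M)) \<inter> space ?\<Omega> =
      (\<lambda>\<omega>. \<omega> k) -` D \<inter> space ?\<Omega>"
    by (auto simp: space_PiM)
  have vimage_Pair_Times: "(\<lambda>x. (f x, g x)) -` (U \<times> V) \<inter> W = (f -` U \<inter> W) \<inter> (g -` V \<inter> W)"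
    for f g :: "('i \<Rightarrow> 'a) \<Rightarrow> 'i \<Rightarrow> 'a" and U V W
    by auto
  have "prob (S \<inter> {\<omega>. \<omega> k \<in> D}) = prob (S \<inter> ((\<lambda>\<omega>. \<omega> k) -` D \<inter> space ?\<Omega>))"
    using sets.sets_into_space[OF S] by (intro arg_cong[where f = prob]) auto
  also have "\<dots> = prob S * prob ((\<lambda>\<omega>. \<omega> k) -` D \<inter> space ?\<Omega>)"
    using indep_varD[OF ind Xa Xb] unfolding vimage_Pair_Times Sa Sb .
  also have "prob ((\<lambda>\<omega>. \<omega> k) -` D \<inter> space ?\<Omega>) = measure (M k) D"
    using D by (subst PiM_component[symmetric, of k]) (auto simp: measure_distr)
  finally show ?thesis .
qed

text \<open>
  Under a constant rule the law is realised by independent draws: coins that succeed with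
  probability \<open>p t\<close>, whose first success is the change-point, and pairs of candidate responses with
  distributions \<open>F\<close> and \<open>G\<close>.  The coin at time \<open>t\<close> is read from coordinate \<open>2t\<close> and the pair from
  coordinate \<open>2t + 1\<close>, so that both conditions of the model say that a coordinate is independent of
  those before it.
\<close>

locale coin_model =
  fixes p :: "nat \<Rightarrow> real" and F G :: "('y :: polish_space) measure"
  assumes p: "\<And>t. 0 \<le> p t" "\<And>t. p t \<le> 1"
    and F: "prob_space F" "sets F = sets borel"
    and G: "prob_space G" "sets G = sets borel"
begin

definition coordinate :: "nat \<Rightarrow> (bool \<times> 'y \<times> 'y) measure" where
  "coordinate i = measure_pmf (bernoulli_pmf (p (i div 2))) \<Otimes>\<^sub>M (F \<Otimes>\<^sub>M G)"

definition draws :: "(nat \<Rightarrow> bool \<times> 'y \<times> 'y) measure" where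
  "draws = PiM UNIV coordinate"

definition coin :: "nat \<Rightarrow> (nat \<Rightarrow> bool \<times> 'y \<times> 'y) \<Rightarrow> bool" where
  "coin t \<omega> = fst (\<omega> (2 * t))"

definition first_success :: "(nat \<Rightarrow> bool \<times> 'y \<times> 'y) \<Rightarrow> enat" where
  "first_success \<omega> = (if \<exists>t. coin t \<omega> then enat (LEAST t. coin t \<omega>) else \<infinity>)"

definition outcome :: "(nat \<Rightarrow> bool \<times> 'y \<times> 'y) \<Rightarrow> 'y path" where
  "outcome \<omega> = (first_success \<omega>,
     \<lambda>t\<in>{1..}. (if \<forall>s\<le>t. \<not> coin s \<omega> then fst else snd) (snd (\<omega> (2 * t + 1))))"

definition law :: "'y path measure" where
  "law = distr draws path_space outcome"

lemma sets_coordinate [measurable_cong]: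
  "sets (coordinate i) = sets (count_space UNIV \<Otimes>\<^sub>M (borel \<Otimes>\<^sub>M borel))"
  unfolding coordinate_def by (intro sets_pair_measure_cong F G) simp

lemma sets_coordinate_success: "{True} \<times> UNIV \<in> sets (coordinate i)"
  using sets.top[of "borel \<Otimes>\<^sub>M borel :: ('y \<times> 'y) measure"]
  by (auto simp: sets_coordinate space_pair_measure intro!: pair_measureI)

lemma space_coordinate: "space (coordinate i) = UNIV"
  using sets_eq_imp_space_eq[OF sets_coordinate] by (simp add: space_pair_measure)

lemma space_draws: "space draws = UNIV"
  by (simp add: draws_def space_PiM space_coordinate)

lemma prob_space_FG: "prob_space (F \<Otimes>\<^sub>M G)"
proof -
  interpret F: prob_space F by (rule F)
  interpret G: prob_space G by (rule G)
  interpret pair_prob_space F G ..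
  show ?thesis by (rule P.prob_space_axioms)
qed

lemma prob_space_coordinate: "prob_space (coordinate i)"
proof -
  interpret FG: prob_space "F \<Otimes>\<^sub>M G" by (rule prob_space_FG)
  interpret pair_prob_space "measure_pmf (bernoulli_pmf (p (i div 2)))" "F \<Otimes>\<^sub>M G" ..
  show ?thesis unfolding coordinate_def by (rule P.prob_space_axioms)
qed

sublocale product_prob_space coordinate "UNIV :: nat set"
  by (intro product_prob_spaceI prob_space_coordinate)

lemma measure_coordinate_coin: "measure (coordinate (2 * t)) ({True} \<times> UNIV) = p t"
proof -
  interpret FG: prob_space "F \<Otimes>\<^sub>M G" by (rule prob_space_FG)
  have "space (F \<Otimes>\<^sub>M G) = UNIV"
    using sets_eq_imp_space_eq[OF F(2)] sets_eq_imp_space_eq[OF G(2)] by (simp add: space_pair_measure)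
  then show ?thesis
    using p[of t] FG.emeasure_space_1 sets.top[of "F \<Otimes>\<^sub>M G"]
    by (simp add: coordinate_def measure_def FG.emeasure_pair_measure_Times emeasure_pmf_single)
qed

lemma measure_coordinate_response:
  assumes [measurable]: "D \<in> sets borel"
  shows "measure (coordinate i) (UNIV \<times> D \<times> UNIV) = measure F D"
    and "measure (coordinate i) (UNIV \<times> UNIV \<times> D) = measure G D"
proof -
  interpret F: prob_space F by (rule F)
  interpret G: prob_space G by (rule G)
  interpret FG: prob_space "F \<Otimes>\<^sub>M G" by (rule prob_space_FG)
  have [simp]: "space F = UNIV" "space G = UNIV" "UNIV \<in> sets F" "UNIV \<in> sets G" "D \<in> sets F" "D \<in> sets G"
    using sets_eq_imp_space_eq[OF F(2)] sets_eq_imp_space_eq[OF G(2)] F G assms by simp_all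
  have [simp]: "emeasure F UNIV = 1" "emeasure G UNIV = 1"
    using F.emeasure_space_1 G.emeasure_space_1 by simp_all
  show "measure (coordinate i) (UNIV \<times> D \<times> UNIV) = measure F D"
     "measure (coordinate i) (UNIV \<times> UNIV \<times> D) = measure G D"
    by (simp_all add: coordinate_def measure_def FG.emeasure_pair_measure_Times G.emeasure_pair_measure_Times)
qed

lemma first_success_gt_iff: "enat t < first_success \<omega> \<longleftrightarrow> (\<forall>s\<le>t. \<not> coin s \<omega>)"
proof (cases "\<exists>t. coin t \<omega>")
  case True
  then have "coin (LEAST t. coin t \<omega>) \<omega>" by (rule LeastI_ex)
  then have "t < (LEAST t. coin t \<omega>) \<longleftrightarrow> (\<forall>s\<le>t. \<not> coin s \<omega>)"
    by (auto dest: not_less_Least le_less_trans) (meson leI)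
  moreover have "first_success \<omega> = enat (LEAST t. coin t \<omega>)"
    using True by (simp add: first_success_def)
  ultimately show ?thesis by simp
qed (auto simp: first_success_def)

lemma latent_outcome: "latent t (outcome \<omega>) = (if \<forall>s\<le>t. \<not> coin s \<omega> then 0 else 1)"
  by (simp add: latent_def change_point_def outcome_def first_success_gt_iff)

lemma response_outcome:
  "t \<ge> 1 \<Longrightarrow> response t (outcome \<omega>) = (if \<forall>s\<le>t. \<not> coin s \<omega> then fst else snd) (snd (\<omega> (2 * t + 1)))"
  by (simp add: response_def outcome_def)

lemma measurable_draws_component [measurable]:
  "(\<lambda>\<omega>. \<omega> i) \<in> draws \<rightarrow>\<^sub>M count_space UNIV \<Otimes>\<^sub>M (borel \<Otimes>\<^sub>M borel)"
proof -
  have "(\<lambda>\<omega>. \<omega> i) \<in> draws \<rightarrow>\<^sub>M coordinate i"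
    unfolding draws_def by (rule measurable_component_singleton) simp
  then show ?thesis
    using measurable_cong_sets[OF refl sets_coordinate] by blast
qed

lemma measurable_coin [measurable]: "Measurable.pred draws (coin t)"
  unfolding coin_def[abs_def] by measurable

lemma measurable_first_success [measurable]: "first_success \<in> draws \<rightarrow>\<^sub>M count_space UNIV"
proof -
  have "(\<lambda>\<omega>. LEAST t. coin t \<omega>) \<in> draws \<rightarrow>\<^sub>M count_space UNIV"
    by measurable
  then have "(\<lambda>\<omega>. enat (LEAST t. coin t \<omega>)) \<in> draws \<rightarrow>\<^sub>M count_space UNIV"
    by (rule measurable_compose) simp
  then show ?thesis
    unfolding first_success_def[abs_def] by (intro measurable_If) (simp_all, measurable)
qed

lemma measurable_outcome: "outcome \<in> draws \<rightarrow>\<^sub>M path_space"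
proof -
  have "(\<lambda>\<omega>. (if \<forall>s\<le>t. \<not> coin s \<omega> then fst else snd) (snd (\<omega> (2 * t + 1)))) =
      (\<lambda>\<omega>. if \<forall>s\<le>t. \<not> coin s \<omega> then fst (snd (\<omega> (2 * t + 1))) else snd (snd (\<omega> (2 * t + 1))))" for t
    by (rule ext) auto
  moreover have "(\<lambda>\<omega>. if \<forall>s\<le>t. \<not> coin s \<omega> then fst (snd (\<omega> (2 * t + 1))) else snd (snd (\<omega> (2 * t + 1)))) \<in> draws \<rightarrow>\<^sub>M borel" for t
    by measurable
  ultimately show ?thesis
    unfolding outcome_def[abs_def] path_space_def
    by (intro measurable_Pair measurable_first_success measurable_restrict) simp
qed

lemma prob_space_draws: "prob_space draws"
  unfolding draws_def by (rule prob_space_axioms)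

lemma prob_space_law: "prob_space law"
  unfolding law_def by (rule prob_space.prob_space_distr[OF prob_space_draws measurable_outcome])

lemma sets_law: "sets law = sets path_space" and space_law: "space law = space path_space"
  by (simp_all add: law_def)

lemma measure_law:
  "B \<in> sets path_space \<Longrightarrow> measure law B = measure draws (outcome -` B)"
  by (simp add: law_def measure_distr[OF measurable_outcome] space_draws)

lemma outcome_in_space: "outcome \<omega> \<in> space path_space"
  using measurable_space[OF measurable_outcome, of \<omega>] by (simp add: space_draws)

lemma measure_law_Int:
  assumes B: "B \<in> sets path_space" and E: "E \<in> sets path_space" and D: "D \<in> sets (coordinate k)"
    and past: "\<And>\<omega> \<omega>'. outcome \<omega> \<in> B \<Longrightarrow> (\<And>i. i < k \<Longrightarrow> \<omega> i = \<omega>' i) \<Longrightarrow> outcome \<omega>' \<in> B"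
    and BE: "\<And>\<omega>. outcome \<omega> \<in> B \<Longrightarrow> outcome \<omega> \<in> E \<longleftrightarrow> \<omega> k \<in> D"
  shows "measure law (B \<inter> E) = measure (coordinate k) D * measure law B"
proof -
  have "outcome -` (B \<inter> E) = outcome -` B \<inter> {\<omega>. \<omega> k \<in> D}"
    using BE by (intro set_eqI) (simp only: vimage_eq Int_iff mem_Collect_eq, blast)
  moreover have S: "outcome -` B \<in> sets (PiM UNIV coordinate)"
    using measurable_sets[OF measurable_outcome B] by (simp add: space_draws) (simp add: draws_def)
  have "measure draws (outcome -` B \<inter> {\<omega>. \<omega> k \<in> D}) = measure draws (outcome -` B) * measure (coordinate k) D"
    unfolding draws_def
    by (rule measure_PiM_indep_past[where M = coordinate and k = k and D = D])
      (auto intro: S past prob_space_coordinate D)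
  ultimately show ?thesis
    using B E by (simp add: measure_law sets.Int)
qed

lemma measure_law_latent_0: "measure law {\<omega>\<in>space law. latent 0 \<omega> = 1} = p 0"
proof -
  have "measure law (space path_space \<inter> {\<omega>\<in>space law. latent 0 \<omega> = 1}) =
      measure (coordinate (2 * 0)) ({True} \<times> UNIV) * measure law (space path_space)"
  proof (rule measure_law_Int)
    show "{\<omega>\<in>space law. latent 0 \<omega> = 1} \<in> sets path_space"
      using measurable_sets[OF measurable_latent, of "{1}" 0]
      by (simp add: space_law vimage_def Int_def conj_commute)
    show "outcome \<omega> \<in> {\<omega>\<in>space law. latent 0 \<omega> = 1} \<longleftrightarrow> \<omega> (2 * 0) \<in> {True} \<times> UNIV" for \<omega>
      by (cases "\<omega> (2 * 0)") (simp add: space_law outcome_in_space latent_outcome coin_def)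
  qed (auto simp: sets_coordinate_success outcome_in_space)
  moreover have "measure law (space path_space) = 1"
    using prob_space.prob_space[OF prob_space_law] by (simp add: space_law)
  ultimately show ?thesis
    unfolding measure_coordinate_coin by (simp add: space_law Int_def)
qed

lemma history_outcome_cong:
  assumes "\<And>i. i < 2 * t \<Longrightarrow> \<omega> i = \<omega>' i" and "t \<ge> 1"
  shows "s < t \<Longrightarrow> latent s (outcome \<omega>) = latent s (outcome \<omega>')"
    and "history (\<lambda>_ _. x) (t - 1) (outcome \<omega>) = history (\<lambda>_ _. x) (t - 1) (outcome \<omega>')"
proof -
  have coin: "coin s \<omega> = coin s \<omega>'" if "s < t" for s
    using assms(1)[of "2 * s"] that by (simp add: coin_def)
  then show "s < t \<Longrightarrow> latent s (outcome \<omega>) = latent s (outcome \<omega>')"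
    by (simp add: latent_outcome)
  have "response s (outcome \<omega>) = response s (outcome \<omega>')" if "1 \<le> s" "s < t" for s
    using assms(1)[of "2 * s + 1"] that coin by (simp add: response_outcome)
  then show "history (\<lambda>_ _. x) (t - 1) (outcome \<omega>) = history (\<lambda>_ _. x) (t - 1) (outcome \<omega>')"
    using \<open>t \<ge> 1\<close> by (auto simp: history_def fun_eq_iff restrict_def)
qed

lemma AE_law_transition:
  assumes X: "assignment_rule K (\<lambda>_ (_ :: 'y path). x)" and t: "t \<ge> 1"
  shows "AE \<omega> in law. latent (t - 1) \<omega> = 0 \<longrightarrow>
    real_cond_exp law (transition_algebra K (\<lambda>_ _. x) t) (indicat_real {\<omega>\<in>space law. latent t \<omega> = 1}) \<omega> = p t"
proof -
  let ?H = "\<lambda>\<omega> :: 'y path. (latent (t - 1) \<omega>, history (\<lambda>_ _. x) (t - 1) \<omega>, x)"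
  let ?N = "count_space {0, 1} \<Otimes>\<^sub>M history_space K (t - 1) \<Otimes>\<^sub>M count_space {1..K}"
  let ?F = "transition_algebra K (\<lambda>_ (_ :: 'y path). x) t"
  let ?A = "{\<omega>\<in>space (path_space :: 'y path measure). latent (t - 1) \<omega> = 0}" and ?E = "{\<omega>\<in>space law. latent t \<omega> = 1}"
  interpret prob_space law by (rule prob_space_law)
  have H: "?H \<in> path_space \<rightarrow>\<^sub>M ?N"
    by (intro measurable_Pair measurable_latent measurable_history[OF X]
        measurable_assignment[OF X t])
  have F: "?F = vimage_algebra (space path_space) ?H ?N"
    by (simp add: transition_algebra_def)
  have sub: "subalgebra path_space ?F"
    by (rule subalgebra_transition_algebra[OF X t])
  interpret finite_measure_subalgebra law ?F
    by unfold_locales (use sub in \<open>simp add: subalgebra_def space_law sets_law\<close>)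
  have "fst \<in> ?N \<rightarrow>\<^sub>M count_space {0, 1}"
    by measurable
  from measurable_sets[OF this, of "{0}"] have "fst -` {0} \<inter> space ?N \<in> sets ?N"
    by simp
  then have "?H -` (fst -` {0} \<inter> space ?N) \<inter> space path_space \<in> sets ?F"
    unfolding F by (rule in_vimage_algebra)
  moreover have "?H -` (fst -` {0} \<inter> space ?N) \<inter> space path_space = ?A"
    using measurable_space[OF H]
    by (intro set_eqI) (simp only: vimage_eq Int_iff mem_Collect_eq singleton_iff fst_conv, blast)
  ultimately have A: "?A \<in> sets ?F"
    by (simp only:)
  have E: "?E \<in> sets path_space"
    using measurable_sets[OF measurable_latent, of "{1}" t]
    by (simp add: space_law vimage_def Int_def conj_commute)
  have "AE \<omega> in law. \<omega> \<in> ?A \<longrightarrow> real_cond_exp law ?F (indicat_real ?E) \<omega> = p t"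
  proof (rule real_cond_exp_indicator_const[OF A])
    show "?E \<in> events" using E by (simp add: sets_law)
    fix B assume B: "B \<in> sets ?F" "B \<subseteq> ?A"
    have "prob (B \<inter> ?E) = measure (coordinate (2 * t)) ({True} \<times> UNIV) * prob B"
    proof (rule measure_law_Int[OF _ E])
      show "B \<in> sets path_space" using B(1) sub by (auto simp: subalgebra_def)
      show "{True} \<times> UNIV \<in> sets (coordinate (2 * t))"
        by (rule sets_coordinate_success)
      show "outcome \<omega>' \<in> B" if "outcome \<omega> \<in> B" "\<And>i. i < 2 * t \<Longrightarrow> \<omega> i = \<omega>' i" for \<omega> \<omega>'
      proof (rule in_vimage_algebra_cong[OF B(1)[unfolded F] _ that(1) outcome_in_space])
        show "?H (outcome \<omega>) = ?H (outcome \<omega>')"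
          using history_outcome_cong(1)[OF that(2) t, where s = "t - 1"] history_outcome_cong(2)[OF that(2) t, where x = x] t
          by simp
      qed (use measurable_space[OF H] in \<open>rule Pi_I\<close>)
      show "outcome \<omega> \<in> ?E \<longleftrightarrow> \<omega> (2 * t) \<in> {True} \<times> UNIV" if "outcome \<omega> \<in> B" for \<omega>
      proof -
        have "latent (t - 1) (outcome \<omega>) = 0"
          using subsetD[OF B(2) that] by simp
        then have "\<forall>s\<le>t - 1. \<not> coin s \<omega>"
          unfolding latent_outcome by presburger
        moreover have "s \<le> t - 1 \<or> s = t" if "s \<le> t" for s
          using that t by linarith
        ultimately have "(\<forall>s\<le>t. \<not> coin s \<omega>) \<longleftrightarrow> \<not> coin t \<omega>"
          by blast
        then show ?thesis
          by (cases "\<omega> (2 * t)") (simp add: space_law outcome_in_space latent_outcome coin_def)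
      qed
    qed
    then show "prob (B \<inter> ?E) = p t * prob B"
      by (simp only: measure_coordinate_coin)
  qed
  with AE_space[of law] show ?thesis
    by eventually_elim (simp add: space_law)
qed

lemma AE_law_response:
  assumes X: "assignment_rule K (\<lambda>_ (_ :: 'y path). x)" and t: "t \<ge> 1" and D: "D \<in> sets borel"
  shows "AE \<omega> in law.
    real_cond_exp law (response_algebra K (\<lambda>_ _. x) t) (indicat_real {\<omega>\<in>space law. response t \<omega> \<in> D}) \<omega>
      = measure (if latent t \<omega> = 0 then F else G) D"
proof -
  let ?H = "\<lambda>\<omega> :: 'y path. (\<lambda>s\<in>{0..t}. latent s \<omega>, history (\<lambda>_ _. x) (t - 1) \<omega>, x)"
  let ?N = "PiM {0..t} (\<lambda>_. count_space {0, 1}) \<Otimes>\<^sub>M history_space K (t - 1) \<Otimes>\<^sub>M count_space {1..K}"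
  let ?F = "response_algebra K (\<lambda>_ (_ :: 'y path). x) t"
  let ?A = "\<lambda>l. {\<omega>\<in>space (path_space :: 'y path measure). latent t \<omega> = l}" and ?E = "{\<omega>\<in>space law. response t \<omega> \<in> D}"
  interpret prob_space law by (rule prob_space_law)
  have H: "?H \<in> path_space \<rightarrow>\<^sub>M ?N"
    by (intro measurable_Pair measurable_restrict measurable_latent measurable_history[OF X]
        measurable_assignment[OF X t])
  have F: "?F = vimage_algebra (space path_space) ?H ?N"
    by (simp add: response_algebra_def)
  have sub: "subalgebra path_space ?F"
    by (rule subalgebra_response_algebra[OF X t])
  interpret finite_measure_subalgebra law ?F
    by unfold_locales (use sub in \<open>simp add: subalgebra_def space_law sets_law\<close>)
  have A: "?A l \<in> sets ?F" if "l \<in> {0, 1}" for l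
  proof -
    have "(\<lambda>\<eta>. fst \<eta> t) \<in> ?N \<rightarrow>\<^sub>M count_space {0, 1}"
      by measurable
    from measurable_sets[OF this, of "{l}"] that
    have "(\<lambda>\<eta>. fst \<eta> t) -` {l} \<inter> space ?N \<in> sets ?N" by simp
    then have "?H -` ((\<lambda>\<eta>. fst \<eta> t) -` {l} \<inter> space ?N) \<inter> space path_space \<in> sets ?F"
      unfolding F by (rule in_vimage_algebra)
    moreover have "?H -` ((\<lambda>\<eta>. fst \<eta> t) -` {l} \<inter> space ?N) \<inter> space path_space = ?A l"
      using measurable_space[OF H]
      by (intro set_eqI) (simp only: vimage_eq Int_iff mem_Collect_eq singleton_iff fst_conv
          restrict_apply' atLeastAtMost_iff le0 order_refl simp_thms, blast)
    ultimately show ?thesis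
      by (simp only:)
  qed
  have E: "?E \<in> sets path_space"
    using measurable_sets[OF measurable_response[OF t] D]
    by (simp add: space_law vimage_def Int_def conj_commute)
  have AE_l: "AE \<omega> in law. \<omega> \<in> ?A l \<longrightarrow> real_cond_exp law ?F (indicat_real ?E) \<omega> = measure (if l = 0 then F else G) D"
    if l: "l \<in> {0, 1}" for l
  proof (rule real_cond_exp_indicator_const[OF A[OF l]])
    show "?E \<in> events" using E by (simp add: sets_law)
    fix B assume B: "B \<in> sets ?F" "B \<subseteq> ?A l"
    let ?D = "UNIV \<times> (if l = 0 then D \<times> UNIV else UNIV \<times> D)"
    have "measure (if l = 0 then F else G) D = measure (coordinate (2 * t + 1)) ?D"
      by (simp add: measure_coordinate_response[OF D])
    also have "prob (B \<inter> ?E) = \<dots> * prob B"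
    proof (rule measure_law_Int[OF _ E])
      show "B \<in> sets path_space" using B(1) sub by (auto simp: subalgebra_def)
      show "?D \<in> sets (coordinate (2 * t + 1))"
        using D by (auto simp: sets_coordinate intro!: pair_measureI)
      show "outcome \<omega>' \<in> B" if "outcome \<omega> \<in> B" "\<And>i. i < 2 * t + 1 \<Longrightarrow> \<omega> i = \<omega>' i" for \<omega> \<omega>'
      proof (rule in_vimage_algebra_cong[OF B(1)[unfolded F] _ that(1) outcome_in_space])
        have "coin s \<omega> = coin s \<omega>'" if "s \<le> t" for s
          using \<open>\<And>i. i < 2 * t + 1 \<Longrightarrow> \<omega> i = \<omega>' i\<close>[of "2 * s"] that by (simp add: coin_def)
        then have "(\<lambda>s\<in>{0..t}. latent s (outcome \<omega>)) = (\<lambda>s\<in>{0..t}. latent s (outcome \<omega>'))"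
          by (auto simp: fun_eq_iff restrict_def latent_outcome)
        moreover have "history (\<lambda>_ _. x) (t - 1) (outcome \<omega>) = history (\<lambda>_ _. x) (t - 1) (outcome \<omega>')"
          by (rule history_outcome_cong(2)[OF _ t]) (simp add: that(2))
        ultimately show "?H (outcome \<omega>) = ?H (outcome \<omega>')" by simp
      qed (use measurable_space[OF H] in \<open>rule Pi_I\<close>)
      show "outcome \<omega> \<in> ?E \<longleftrightarrow> \<omega> (2 * t + 1) \<in> ?D" if "outcome \<omega> \<in> B" for \<omega>
      proof -
        have "latent t (outcome \<omega>) = l"
          using subsetD[OF B(2) that] by simp
        then have "(\<forall>s\<le>t. \<not> coin s \<omega>) \<longleftrightarrow> l = 0"
          unfolding latent_outcome by (metis zero_neq_one)
        then have "response t (outcome \<omega>) = (if l = 0 then fst else snd) (snd (\<omega> (2 * t + 1)))"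
          using t by (simp only: response_outcome)
        then show ?thesis
          by (cases "\<omega> (2 * t + 1)") (simp add: space_law outcome_in_space)
      qed
    qed
    finally show "prob (B \<inter> ?E) = measure (if l = 0 then F else G) D * prob B" .
  qed
  from AE_l[OF insertI1] AE_l[OF insertI2[OF singletonI]] AE_space[of law] show ?thesis
    by eventually_elim (auto simp: space_law latent_def split: if_splits)
qed

end

lemma stat_const: "stat \<Phi> (\<lambda>_ _. x) \<zeta> t \<omega> = (\<Phi> x ^^ t) \<zeta>"
  by (induction t) simp_all

lemma assignment_rule_const: "x \<in> {1..K} \<Longrightarrow> assignment_rule K (\<lambda>_ _. x)"
  unfolding assignment_rule_def by (intro allI impI bexI[of _ "\<lambda>_. x"]) auto

lemma prob_space_density:
  assumes "prob_density \<mu> h"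
  shows "prob_space (density \<mu> (\<lambda>y. ennreal (h y)))"
proof
  have [measurable]: "h \<in> borel_measurable \<mu>" using assms by (simp add: prob_density_def)
  have "emeasure (density \<mu> (\<lambda>y. ennreal (h y))) (space \<mu>) = (\<integral>\<^sup>+ y. ennreal (h y) \<partial>\<mu>)"
    by (subst emeasure_density) (auto intro!: nn_integral_cong)
  then show "emeasure (density \<mu> (\<lambda>y. ennreal (h y))) (space (density \<mu> (\<lambda>y. ennreal (h y)))) = 1"
    using assms by (simp add: prob_density_def)
qed

lemma ex_cp_law_const:
  fixes \<mu> :: "('y :: polish_space) measure"
  assumes \<mu>: "sets \<mu> = sets borel" and f: "prob_density \<mu> (f x)" and g: "prob_density \<mu> (g x)"
    and \<Psi>: "\<And>t. \<Psi> x ((\<Phi> x ^^ t) \<zeta>) \<in> {0..1}" and x: "x \<in> {1..K}" and "\<gamma> \<ge> 0"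
  shows "\<exists>P :: 'y path measure. cp_law K \<mu> f g \<Psi> \<Phi> (\<lambda>_ _. x) \<gamma> \<zeta> P"
proof -
  define p where "p t = (case t of 0 \<Rightarrow> \<gamma> / (1 + \<gamma>) | Suc n \<Rightarrow> \<Psi> x ((\<Phi> x ^^ n) \<zeta>))" for t
  interpret coin_model p "density \<mu> (\<lambda>y. ennreal (f x y))" "density \<mu> (\<lambda>y. ennreal (g x y))"
  proof (rule coin_model.intro)
    show "0 \<le> p t" "p t \<le> 1" for t
      using \<open>\<gamma> \<ge> 0\<close> \<Psi> by (auto simp: p_def divide_simps split: nat.split)
  qed (simp_all add: \<mu> prob_space_density f g)
  note X = assignment_rule_const[OF x]
  have p: "p t = \<Psi> x (stat \<Phi> (\<lambda>_ _. x) \<zeta> (t - 1) \<omega>)" if "t \<ge> 1" for t and \<omega> :: "'y path"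
    using that by (cases t) (simp_all add: p_def stat_const)
  have 1: "\<forall>t\<ge>1. AE \<omega> in law. latent (t - 1) \<omega> = 0 \<longrightarrow>
      real_cond_exp law (transition_algebra K (\<lambda>_ _. x) t) (indicat_real {\<omega>\<in>space law. latent t \<omega> = 1}) \<omega>
        = \<Psi> x (stat \<Phi> (\<lambda>_ _. x) \<zeta> (t - 1) \<omega>)"
  proof (intro allI impI)
    fix t :: nat assume t: "t \<ge> 1"
    from AE_law_transition[OF X t]
    show "AE \<omega> in law. latent (t - 1) \<omega> = 0 \<longrightarrow>
      real_cond_exp law (transition_algebra K (\<lambda>_ _. x) t) (indicat_real {\<omega>\<in>space law. latent t \<omega> = 1}) \<omega>
        = \<Psi> x (stat \<Phi> (\<lambda>_ _. x) \<zeta> (t - 1) \<omega>)"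
      unfolding p[OF t, symmetric] .
  qed
  have 2: "\<forall>t\<ge>1. \<forall>B\<in>sets borel. AE \<omega> in law.
      real_cond_exp law (response_algebra K (\<lambda>_ _. x) t) (indicat_real {\<omega>\<in>space law. response t \<omega> \<in> B}) \<omega>
        = measure (density \<mu> (\<lambda>y. ennreal ((if latent t \<omega> = 0 then f else g) x y))) B"
  proof (intro allI impI ballI)
    fix t :: nat and B :: "'y set" assume "t \<ge> 1" "B \<in> sets borel"
    from AE_law_response[OF X this]
    show "AE \<omega> in law.
      real_cond_exp law (response_algebra K (\<lambda>_ _. x) t) (indicat_real {\<omega>\<in>space law. response t \<omega> \<in> B}) \<omega>
        = measure (density \<mu> (\<lambda>y. ennreal ((if latent t \<omega> = 0 then f else g) x y))) B"
      by eventually_elim (simp split: if_splits)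
  qed
  have 0: "measure law {\<omega>\<in>space law. latent 0 \<omega> = 1} = \<gamma> / (1 + \<gamma>)"
    unfolding measure_law_latent_0 by (simp add: p_def)
  have "cp_law K \<mu> f g \<Psi> \<Phi> (\<lambda>_ _. x) \<gamma> \<zeta> law"
    unfolding cp_law_def by (intro conjI prob_space_law sets_law 0 1 2)
  then show ?thesis ..
qed

lemma optimal_cost_finite:
  fixes \<mu> :: "('y :: polish_space) measure"
  assumes P: "cp_law K \<mu> f g \<Psi> \<Phi> (\<lambda>_ _. x) \<gamma> \<zeta> P" and x: "x \<in> {1..K}"
  shows "optimal_cost K \<mu> f g \<Psi> \<Phi> c \<gamma> \<zeta> 0 < \<infinity>"
proof -
  interpret prob_space P using P by (simp add: cp_law_def)
  have "{\<omega>\<in>space path_space. (0 :: enat) \<le> enat t} \<in> sets (filt K (\<lambda>_ (_ :: 'y path). x) t)" for t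
    using sets.top[of "filt K (\<lambda>_ (_ :: 'y path). x) t"] by (simp add: filt_def)
  then have "((\<lambda>_ (_ :: 'y path). x), (\<lambda>_. 0)) \<in> procedures K"
    by (simp add: procedures_def obs_stopping_time_def assignment_rule_const[OF x])
  from optimal_cost_le[OF this P, of c]
  have "optimal_cost K \<mu> f g \<Psi> \<Phi> c \<gamma> \<zeta> 0 \<le> emeasure P {\<omega>\<in>space P. 0 < change_point \<omega>}"
    by simp
  also have "\<dots> < \<infinity>"
    by (simp add: emeasure_eq_measure)
  finally show ?thesis .
qed

theorem lemmaB1:
  fixes K \<kappa> :: nat
    and \<mu> :: "('y::polish_space) measure"
    and f g :: "nat \<Rightarrow> 'y \<Rightarrow> real"
    and \<Psi> :: "nat \<Rightarrow> (nat \<Rightarrow> real) \<Rightarrow> real"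
    and \<Phi> :: "nat \<Rightarrow> (nat \<Rightarrow> real) \<Rightarrow> (nat \<Rightarrow> real)"
    and c :: real and \<zeta> :: "nat \<Rightarrow> real" and \<delta> :: nat
  assumes "K \<ge> 2"
    and "sigma_finite_measure \<mu>" and "sets \<mu> = sets borel"
    and "\<And>x. x \<in> {1..K} \<Longrightarrow> prob_density \<mu> (f x)"
    and "\<And>x. x \<in> {1..K} \<Longrightarrow> prob_density \<mu> (g x)"
    and "\<And>x s. x \<in> {1..K} \<Longrightarrow> s \<in> reals_pow \<kappa> \<Longrightarrow> \<Psi> x s \<in> {0..<1}"
    and "\<And>x s. x \<in> {1..K} \<Longrightarrow> s \<in> reals_pow \<kappa> \<Longrightarrow> \<Phi> x s \<in> reals_pow \<kappa>"
    and "c > 0" and "\<zeta> \<in> reals_pow \<kappa>" and "\<delta> \<in> {0, 1}"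
  shows "(\<forall>\<gamma>\<ge>0. optimal_cost K \<mu> f g \<Psi> \<Phi> c \<gamma> \<zeta> \<delta> < \<infinity>) \<and>
    concave_on {0..} (\<lambda>\<gamma>. (1 + \<gamma>) * enn2real (optimal_cost K \<mu> f g \<Psi> \<Phi> c \<gamma> \<zeta> \<delta>))"
proof (cases "\<delta> = 0")
  case True
  have x: "1 \<in> {1..K}" using assms(1) by simp
  have "(\<Phi> 1 ^^ t) \<zeta> \<in> reals_pow \<kappa>" for t
    by (induction t) (use assms x in auto)
  then have \<Psi>: "\<Psi> 1 ((\<Phi> 1 ^^ t) \<zeta>) \<in> {0..1}" for t
    using assms(6)[OF x, of "(\<Phi> 1 ^^ t) \<zeta>"] by (simp add: less_imp_le)
  have fin: "optimal_cost K \<mu> f g \<Psi> \<Phi> c \<gamma> \<zeta> 0 < \<infinity>" if \<gamma>: "\<gamma> \<ge> 0" for \<gamma>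
  proof -
    obtain P where "cp_law K \<mu> f g \<Psi> \<Phi> (\<lambda>_ _. 1) \<gamma> \<zeta> P"
      using ex_cp_law_const[where x = 1 and f = f and g = g and \<Psi> = \<Psi> and \<Phi> = \<Phi>,
        OF assms(3) assms(4)[OF x] assms(5)[OF x] \<Psi> x \<gamma>] ..
    then show ?thesis
      by (rule optimal_cost_finite[OF _ x])
  qed
  with concave_optimal_cost[OF fin] show ?thesis
    unfolding True by blast
next
  case False
  then have "optimal_cost K \<mu> f g \<Psi> \<Phi> c \<gamma> \<zeta> \<delta> = 0" for \<gamma>
    using assms(10) by (simp add: optimal_cost_def)
  then show ?thesis by (simp add: concave_on_const)
qed

end
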